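(* Assume that there are functions $a:[1,T]\to\mathbb{R}_+$ and $b:[1,T]\to\mathbb{R}$ such that $|f(k,t)|\le a(k)|t|^{q(k)}+b(k)$ for all $t\in\mathbb{R}$ and all $k\in[1,T]$, and let $f(k,0)\ne0$ for at least one $k\in[1,T]$. Consider the problem $$\Delta\left(|\Delta u(k-1)|^{p(k-1)-2}\Delta u(k-1)\right)=\lambda f(k,u(k))\ (k\in[1,T]),\qquad u(0)=u(T+1)=0. \quad (P_\lambda)$$ If $p^->q^++1$, then $(P_\lambda)$ has at least one nontrivial solution for every $\lambda>0$. If $p^-=q^++1$, then there is $\lambda^\star>0$ such that for every $\lambda\in(0,\lambda^\star)$ problem $(P_\lambda)$ has at least one nontrivial solution.
   Context: $T\ge 1$ is an integer; for integers $a<b$, $[a,b]$ denotes the discrete interval $\{a,a+1,\dots,b\}$ (with $[1,1]=\{1\}$). $\mathbb{R}_+$ denotes the positive reals. $\lambda>0$ is a numerical parameter. $p:[0,T+1]\to\mathbb{R}_+$ satisfies $p^->1$, where $p^-=\min_{k\in[0,T+1]}p(k)$. $q:[0,T+1]\to\mathbb{R}_+$ is the conjugate exponent, $\frac1{p(k)}+\frac1{q(k)}=1$, with $q^+=\max_{k\in[0,T+1]}q(k)$. $f:[0,T+1]\times\mathbb{R}\to\mathbb{R}$ is a function. $\Delta$ is the forward difference operator, $\Delta v(k-1)=v(k)-v(k-1)$; thus, with $\phi_j(x)=|x|^{p(j)-2}x$ (and $\phi_j(0)=0$), the left side of the equation at $k$ is $\phi_k(u(k+1)-u(k))-\phi_{k-1}(u(k)-u(k-1))$.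 A solution is a function $u:[0,T+1]\to\mathbb{R}$ satisfying the equation and the boundary conditions; it is nontrivial if it is not identically $0$.
   Formalization: It is additionally assumed that t ↦ f(k,t) is continuous for each k in [1,T]; without this the claim fails, e.g. T=1, p=3, q=3/2, a=b=1, f(1,t)=1 for t≥0 and −1 for t<0, where no solution exists for any λ>0. *)

theory Defs
  imports Complex_Main
begin

definition fdiff :: "(nat \<Rightarrow> real) \<Rightarrow> nat \<Rightarrow> real" where
  "fdiff v k = v (k + 1) - v k"

text \<open>At \<open>x = 0\<close> this is \<open>0\<close> for every exponent \<open>r\<close>, since \<open>0 powr (r - 2) = 0\<close>.\<close>

definition phi :: "real \<Rightarrow> real \<Rightarrow> real" where
  "phi r x = \<bar>x\<bar> powr (r - 2) * x"

text \<open>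
  Functions on a discrete interval are total functions on \<open>nat\<close> of which only the values on that
  interval are used. The truncated subtraction \<open>k - 1\<close> is harmless, as \<open>k \<ge> 1\<close>.
\<close>

definition is_solution ::
  "nat \<Rightarrow> (nat \<Rightarrow> real) \<Rightarrow> (nat \<Rightarrow> real \<Rightarrow> real) \<Rightarrow> real \<Rightarrow> (nat \<Rightarrow> real) \<Rightarrow> bool" where
  "is_solution T p f lam u \<longleftrightarrow>
     (\<forall>k\<in>{1..T}. fdiff (\<lambda>j. phi (p j) (fdiff u j)) (k - 1) = lam * f k (u k)) \<and>
     u 0 = 0 \<and> u (T + 1) = 0"

definition nontrivial :: "nat \<Rightarrow> (nat \<Rightarrow> real) \<Rightarrow> bool" where
  "nontrivial T u \<longleftrightarrow> (\<exists>k\<in>{0..T + 1}. u k \<noteq> 0)"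

definition p_minus :: "nat \<Rightarrow> (nat \<Rightarrow> real) \<Rightarrow> real" where
  "p_minus T p = Min (p ` {0..T + 1})"

definition q_plus :: "nat \<Rightarrow> (nat \<Rightarrow> real) \<Rightarrow> real" where
  "q_plus T q = Max (q ` {0..T + 1})"

text \<open>
  For \<open>f k\<close> that is not continuous, solutions need not exist: with \<open>T = 1\<close>, constant \<open>p\<close>, and
  \<open>f 1 t = 1\<close> for \<open>t \<ge> 0\<close>, \<open>f 1 t = -1\<close> for \<open>t < 0\<close>, the two sides of the equation have opposite signs.
  Existence statements therefore have to assume continuity of \<open>f k\<close> for \<open>k \<in> {1..T}\<close>.
\<close>

end

theory Submission
  imports Defs
begin

text \<open>
  The proof is by shooting. Written in terms of the fluxes \<open>w k = phi (p k) (fdiff u k)\<close>, the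
  equation is the recursion \<open>w k = w (k - 1) + lam * f k (u k)\<close>, \<open>u (k + 1) = u k + phi_inv (p k) (w k)\<close>,
  where \<open>phi_inv r\<close> is the signed power inverse to \<open>phi r\<close>. So \<open>u 0 = 0\<close> and an initial flux \<open>s\<close> determine \<open>u\<close>, and
  since every \<open>f k\<close> is continuous, \<open>u (T + 1)\<close> depends continuously on \<open>s\<close>. By the intermediate
  value theorem it is enough to find \<open>\<sigma> > 0\<close> such that \<open>u (T + 1)\<close> has the sign of \<open>s\<close> for
  \<open>s = \<sigma>\<close> and for \<open>s = -\<sigma>\<close>; this holds if all the fluxes up to index \<open>T\<close> keep the sign of \<open>s\<close>
  (lemma \<open>solution_if_flux_keeps_sign\<close>).

  The growth condition controls the drift of the flux. Let \<open>P\<close> and \<open>Q\<close> be the smallest value of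
  \<open>p\<close> and the largest value of \<open>q\<close>. While the fluxes are at most \<open>2 * \<sigma>\<close> in absolute value with
  \<open>\<sigma> \<ge> 1\<close>, the values of \<open>u\<close> are of order at most \<open>\<sigma>\<close> to the power \<open>1 / (P - 1)\<close>, hence the total
  drift is at most \<open>lam * K\<close> times \<open>\<sigma>\<close> to the power \<open>\<gamma> = Q / (P - 1)\<close>, where \<open>K\<close> depends on
  neither \<open>lam\<close> nor \<open>\<sigma>\<close> (lemma \<open>flux_drift_bound\<close>). This bootstraps as soon as the drift stays
  below \<open>\<sigma> / 2\<close>. If \<open>P > Q + 1\<close>, then \<open>\<gamma> < 1\<close>, and every large \<open>\<sigma>\<close> works, whatever \<open>lam\<close> is. If
  \<open>P = Q + 1\<close>, then \<open>\<gamma> = 1\<close>, so \<open>\<sigma>\<close> cancels and what remains is that \<open>lam\<close> be at most \<open>1 / (2 * K)\<close>.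

  A solution cannot vanish identically, because then the equation would give \<open>f k 0 = 0\<close> for all \<open>k\<close>.
\<close>

section \<open>The inverse of the power nonlinearity\<close>

definition phi_inv :: "real \<Rightarrow> real \<Rightarrow> real" where
  "phi_inv r y = sgn y * \<bar>y\<bar> powr (1 / (r - 1))"

lemma phi_phi_inv:
  assumes "r > 1"
  shows "phi r (phi_inv r y) = y"
proof (cases "y = 0")
  case False
  let ?c = "1 / (r - 1)"
  have "?c * (r - 2) + ?c = 1"
    using assms by (simp add: field_simps)
  then have "(\<bar>y\<bar> powr ?c) powr (r - 2) * \<bar>y\<bar> powr ?c = \<bar>y\<bar>"
    using False by (simp add: powr_powr flip: powr_add)
  then have "phi r (phi_inv r y) = sgn y * \<bar>y\<bar>"
    using False unfolding phi_def phi_inv_def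
    by (simp add: abs_mult mult.left_commute)
  then show ?thesis
    by (simp add: sgn_mult_abs)
qed (simp add: phi_def phi_inv_def)

text \<open>
  Splitting into positive and negative part removes the discontinuous factor \<open>sgn\<close>.
\<close>

lemma continuous_on_phi_inv [continuous_intros]:
  assumes "r > 1" "continuous_on A g"
  shows "continuous_on A (\<lambda>x. phi_inv r (g x))"
proof -
  let ?c = "1 / (r - 1)"
  have "phi_inv r y = max y 0 powr ?c - max (- y) 0 powr ?c" for y
    by (cases y "0::real" rule: linorder_cases) (auto simp: phi_inv_def)
  moreover have "continuous_on A (\<lambda>x. max (g x) 0 powr ?c - max (- g x) 0 powr ?c)"
    using assms by (intro continuous_intros continuous_on_powr') auto
  ultimately show ?thesis
    by simp
qed

lemma phi_inv_pos: "y > 0 \<Longrightarrow> phi_inv r y > 0"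
  by (simp add: phi_inv_def)

lemma phi_inv_neg: "y < 0 \<Longrightarrow> phi_inv r y < 0"
  by (simp add: phi_inv_def)

lemma abs_phi_inv_le:
  assumes "1 < P" "P \<le> r" "\<bar>y\<bar> \<le> x" "1 \<le> x"
  shows "\<bar>phi_inv r y\<bar> \<le> x powr (1 / (P - 1))"
proof -
  have "\<bar>phi_inv r y\<bar> \<le> \<bar>y\<bar> powr (1 / (r - 1))"
    by (cases "y = 0") (auto simp: phi_inv_def abs_mult)
  also have "\<dots> \<le> x powr (1 / (r - 1))"
    using assms by (intro powr_mono2) auto
  also have "\<dots> \<le> x powr (1 / (P - 1))"
    using assms by (intro powr_mono) (auto intro!: divide_left_mono)
  finally show ?thesis .
qed

section \<open>Shooting\<close>

text \<open>
  The step from \<open>k\<close> to \<open>k + 1\<close> uses \<open>p k\<close> for the position and \<open>f (k + 1)\<close> for the flux, so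
  \<open>pos\<close> at \<open>T + 1\<close> involves \<open>f k\<close> for \<open>k \<in> {1..T}\<close> only, which is where \<open>f k\<close> is under control.
\<close>

fun pos flux :: "(nat \<Rightarrow> real) \<Rightarrow> (nat \<Rightarrow> real \<Rightarrow> real) \<Rightarrow> real \<Rightarrow> real \<Rightarrow> nat \<Rightarrow> real" where
  "pos p f lam s 0 = 0"
| "flux p f lam s 0 = s"
| "pos p f lam s (Suc k) = pos p f lam s k + phi_inv (p k) (flux p f lam s k)"
| "flux p f lam s (Suc k) = flux p f lam s k
     + lam * f (Suc k) (pos p f lam s k + phi_inv (p k) (flux p f lam s k))"

lemma flux_Suc: "flux p f lam s (Suc k) = flux p f lam s k + lam * f (Suc k) (pos p f lam s (Suc k))"
  by simp

lemma pos_eq_sum: "pos p f lam s n = (\<Sum>k<n. phi_inv (p k) (flux p f lam s k))"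
  by (induction n) auto

lemma is_solution_pos:
  assumes "\<And>k. k \<le> T \<Longrightarrow> p k > 1" and "pos p f lam s (T + 1) = 0"
  shows "is_solution T p f lam (pos p f lam s)"
proof -
  let ?u = "pos p f lam s"
  have phi_eq: "phi (p k) (fdiff ?u k) = flux p f lam s k" if "k \<le> T" for k
    using assms(1)[OF that] by (simp add: fdiff_def phi_phi_inv)
  have "fdiff (\<lambda>j. phi (p j) (fdiff ?u j)) (k - 1) = lam * f k (?u k)" if k: "k \<in> {1..T}" for k
  proof -
    obtain m where m: "k = Suc m" "Suc m \<le> T"
      using k by (cases k) auto
    have "fdiff (\<lambda>j. phi (p j) (fdiff ?u j)) m = flux p f lam s (Suc m) - flux p f lam s m"
      using m phi_eq[of m] phi_eq[of "Suc m"] by (simp only: fdiff_def[of _ m] Suc_eq_plus1[symmetric])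
    then show ?thesis
      using m by (simp add: flux_Suc del: flux.simps pos.simps)
  qed
  then show ?thesis
    using assms(2) by (simp add: is_solution_def)
qed

lemma continuous_pos_flux:
  assumes "\<And>k. k \<le> T \<Longrightarrow> p k > 1"
    and cont: "\<And>k. k \<in> {1..T} \<Longrightarrow> continuous_on UNIV (f k)"
    and "k \<le> T"
  shows "continuous_on UNIV (\<lambda>s. pos p f lam s k) \<and> continuous_on UNIV (\<lambda>s. flux p f lam s k)"
  using \<open>k \<le> T\<close>
proof (induction k)
  case (Suc k)
  then have "continuous_on UNIV (\<lambda>s. pos p f lam s (Suc k))"
    using assms(1)[of k] by (auto intro!: continuous_intros)
  moreover from this have "continuous_on UNIV (\<lambda>s. f (Suc k) (pos p f lam s (Suc k)))"
    using Suc.prems by (intro continuous_on_compose2[OF cont]) auto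
  ultimately show ?case
    using Suc unfolding flux_Suc by (auto intro!: continuous_intros simp del: pos.simps)
qed (auto intro!: continuous_intros)

text \<open>
  By the hypothesis on the drift, a flux starting at \<open>\<sigma>\<close> stays positive and one starting at \<open>-\<sigma>\<close> stays
  negative. Since \<open>pos\<close> at \<open>T + 1\<close> is the sum of increments with the sign of the flux, it changes
  sign between \<open>-\<sigma>\<close> and \<open>\<sigma>\<close>.
\<close>

lemma solution_if_flux_keeps_sign:
  assumes p: "\<And>k. k \<le> T \<Longrightarrow> p k > 1"
    and cont: "\<And>k. k \<in> {1..T} \<Longrightarrow> continuous_on UNIV (f k)"
    and "\<sigma> > 0"
    and drift: "\<And>s k. \<bar>s\<bar> = \<sigma> \<Longrightarrow> k \<le> T \<Longrightarrow> \<bar>flux p f lam s k - s\<bar> < \<sigma>"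
  shows "\<exists>u. is_solution T p f lam u"
proof -
  let ?g = "\<lambda>s. pos p f lam s (T + 1)"
  have "flux p f lam \<sigma> k > 0" if "k < T + 1" for k
    using drift[of \<sigma> k] \<open>\<sigma> > 0\<close> that by (simp add: abs_less_iff)
  then have right: "0 \<le> ?g \<sigma>"
    unfolding pos_eq_sum by (intro sum_nonneg less_imp_le[OF phi_inv_pos]) auto
  have "flux p f lam (- \<sigma>) k < 0" if "k < T + 1" for k
    using drift[of "- \<sigma>" k] \<open>\<sigma> > 0\<close> that by (simp add: abs_less_iff)
  then have left: "?g (- \<sigma>) \<le> 0"
    unfolding pos_eq_sum by (intro sum_nonpos less_imp_le[OF phi_inv_neg]) auto
  have "continuous_on UNIV ?g"
    using continuous_pos_flux[of T p f T lam] p cont by (auto intro!: continuous_intros)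
  then have "continuous_on {- \<sigma>..\<sigma>} ?g"
    by (rule continuous_on_subset) auto
  then obtain s where "?g s = 0"
    using IVT'[of ?g "- \<sigma>" 0 \<sigma>] left right \<open>\<sigma> > 0\<close> by auto
  then show ?thesis
    using is_solution_pos p by blast
qed

section \<open>The drift of the flux under the growth condition\<close>

text \<open>
  The factor \<open>(T + 1) * 2 powr (1 / (P - 1))\<close> comes from adding at most \<open>T + 1\<close> increments, each
  driven by a flux of size at most \<open>2 * \<sigma>\<close>.
\<close>

definition drift_const ::
  "nat \<Rightarrow> real \<Rightarrow> real \<Rightarrow> (nat \<Rightarrow> real) \<Rightarrow> (nat \<Rightarrow> real) \<Rightarrow> real" where
  "drift_const T P Q a b =
     (\<Sum>k=1..T. a k * (real (T + 1) * 2 powr (1 / (P - 1))) powr Q + \<bar>b k\<bar>)"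

text \<open>
  Bounds on position and drift have to be proved together: the drift up to \<open>k\<close> bounds the flux,
  which bounds the next position, and by the growth condition this bounds the next contribution to
  the drift. As \<open>\<sigma> \<ge> 1\<close>, all exponents may be replaced by the extreme ones \<open>P\<close> and \<open>Q\<close>, and the
  constant \<open>b k\<close> is absorbed into \<open>\<bar>b k\<bar> * \<sigma> powr (Q / (P - 1))\<close>.
\<close>

lemma flux_drift_bound:
  assumes "1 < P" and p: "\<And>k. k \<le> T \<Longrightarrow> P \<le> p k"
    and "0 \<le> Q" and q: "\<And>k. k \<in> {1..T} \<Longrightarrow> 0 \<le> q k \<and> q k \<le> Q"
    and a: "\<And>k. k \<in> {1..T} \<Longrightarrow> a k \<ge> 0"
    and growth: "\<And>k t. k \<in> {1..T} \<Longrightarrow> \<bar>f k t\<bar> \<le> a k * \<bar>t\<bar> powr q k + b k"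
    and "lam > 0" and "\<sigma> \<ge> 1"
    and small: "lam * drift_const T P Q a b * \<sigma> powr (Q / (P - 1)) \<le> \<sigma> / 2"
    and "\<bar>s\<bar> = \<sigma>" and "k \<le> T"
  shows "\<bar>flux p f lam s k - s\<bar> \<le> \<sigma> / 2"
proof -
  define A where "A = (2 * \<sigma>) powr (1 / (P - 1))"
  define M where "M = (real (T + 1) * 2 powr (1 / (P - 1))) powr Q"
  define G where "G = \<sigma> powr (Q / (P - 1))"
  define c where "c j = a j * M + \<bar>b j\<bar>" for j
  have "A \<ge> 1"
    unfolding A_def using \<open>\<sigma> \<ge> 1\<close> \<open>1 < P\<close> by (intro ge_one_powr_ge_zero) auto
  have "G \<ge> 1"
    unfolding G_def using \<open>\<sigma> \<ge> 1\<close> \<open>1 < P\<close> \<open>0 \<le> Q\<close> by (intro ge_one_powr_ge_zero) auto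
  have c_nonneg: "c j \<ge> 0" if "j \<in> {1..T}" for j
    using a[OF that] by (simp add: c_def M_def)
  have partial: "lam * (\<Sum>j=1..n. c j) * G \<le> \<sigma> / 2" if "n \<le> T" for n
  proof -
    have "(\<Sum>j=1..n. c j) \<le> (\<Sum>j=1..T. c j)"
      using that c_nonneg by (intro sum_mono2) auto
    then have "lam * (\<Sum>j=1..n. c j) * G \<le> lam * (\<Sum>j=1..T. c j) * G"
      using \<open>lam > 0\<close> \<open>G \<ge> 1\<close> by (intro mult_right_mono mult_left_mono) auto
    also have "\<dots> \<le> \<sigma> / 2"
      using small by (simp add: drift_const_def c_def M_def G_def)
    finally show ?thesis .
  qed
  have f_bound: "\<bar>f j t\<bar> \<le> c j * G" if j: "j \<in> {1..T}" and t: "\<bar>t\<bar> \<le> real (T + 1) * A" for j t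
  proof -
    have "1 * 1 \<le> real (T + 1) * A"
      using \<open>A \<ge> 1\<close> by (intro mult_mono) auto
    then have "\<bar>t\<bar> powr q j \<le> (real (T + 1) * A) powr Q"
      using q[OF j] t
      by (intro order_trans[OF powr_mono2 powr_mono]) auto
    also have "\<dots> = M * G"
      using \<open>\<sigma> \<ge> 1\<close> by (simp add: A_def M_def G_def powr_mult powr_powr)
    finally have "\<bar>f j t\<bar> \<le> a j * (M * G) + \<bar>b j\<bar> * 1"
      using growth[OF j, of t] a[OF j] mult_left_mono[of "\<bar>t\<bar> powr q j" "M * G" "a j"] by linarith
    also have "\<dots> \<le> a j * (M * G) + \<bar>b j\<bar> * G"
      using \<open>G \<ge> 1\<close> by (intro add_left_mono mult_left_mono) auto
    finally show ?thesis
      by (simp add: c_def algebra_simps)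
  qed
  have "\<bar>pos p f lam s k\<bar> \<le> real k * A \<and> \<bar>flux p f lam s k - s\<bar> \<le> lam * (\<Sum>j=1..k. c j) * G"
    using \<open>k \<le> T\<close>
  proof (induction k)
    case (Suc k)
    then have IH: "\<bar>pos p f lam s k\<bar> \<le> real k * A"
        "\<bar>flux p f lam s k - s\<bar> \<le> lam * (\<Sum>j=1..k. c j) * G"
      by auto
    have "\<bar>flux p f lam s k\<bar> \<le> 2 * \<sigma>"
      using IH(2) partial[of k] Suc.prems \<open>\<bar>s\<bar> = \<sigma>\<close> \<open>\<sigma> \<ge> 1\<close> by linarith
    then have "\<bar>phi_inv (p k) (flux p f lam s k)\<bar> \<le> A"
      unfolding A_def using \<open>1 < P\<close> p[of k] Suc.prems \<open>\<sigma> \<ge> 1\<close> by (intro abs_phi_inv_le) auto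
    then have pos: "\<bar>pos p f lam s (Suc k)\<bar> \<le> real (Suc k) * A"
      using IH(1) by (simp add: algebra_simps)
    also have "\<dots> \<le> real (T + 1) * A"
      using Suc.prems \<open>A \<ge> 1\<close> by (intro mult_right_mono) auto
    finally have "\<bar>f (Suc k) (pos p f lam s (Suc k))\<bar> \<le> c (Suc k) * G"
      using Suc.prems by (intro f_bound) auto
    then have "\<bar>lam * f (Suc k) (pos p f lam s (Suc k))\<bar> \<le> lam * (c (Suc k) * G)"
      using \<open>lam > 0\<close> by (simp add: abs_mult)
    then have "\<bar>flux p f lam s (Suc k) - s\<bar> \<le> lam * (\<Sum>j=1..k. c j) * G + lam * (c (Suc k) * G)"
      using IH(2) unfolding flux_Suc by linarith
    also have "\<dots> = lam * (\<Sum>j=1..Suc k. c j) * G"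
      by (simp add: algebra_simps)
    finally show ?case
      using pos by blast
  qed auto
  then show ?thesis
    using partial[OF \<open>k \<le> T\<close>] by linarith
qed

lemma nontrivial_solution:
  assumes "is_solution T p f lam u" "lam > 0" "\<exists>k\<in>{1..T}. f k 0 \<noteq> 0"
  shows "nontrivial T u"
proof (rule ccontr)
  assume "\<not> nontrivial T u"
  then have zero: "u k = 0" if "k \<le> T + 1" for k
    using that by (auto simp: nontrivial_def)
  obtain k where k: "k \<in> {1..T}" "f k 0 \<noteq> 0"
    using assms(3) by blast
  have "fdiff (\<lambda>j. phi (p j) (fdiff u j)) (k - 1) = lam * f k (u k)"
    using assms(1) k(1) by (simp add: is_solution_def)
  moreover have "u (k - 1) = 0" "u k = 0" "u (k + 1) = 0"
    using k(1) by (auto intro!: zero)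
  ultimately have "lam * f k 0 = 0"
    using k(1) by (simp add: fdiff_def phi_def)
  then show False
    using k(2) \<open>lam > 0\<close> by simp
qed

section \<open>Existence\<close>

theorem theorem5:
  fixes T :: nat
    and p q a b :: "nat \<Rightarrow> real"
    and f :: "nat \<Rightarrow> real \<Rightarrow> real"
  assumes "T \<ge> 1"
    and "\<And>k. k \<in> {0..T + 1} \<Longrightarrow> p k > 0"
    and "p_minus T p > 1"
    and "\<And>k. k \<in> {0..T + 1} \<Longrightarrow> q k > 0"
    and "\<And>k. k \<in> {0..T + 1} \<Longrightarrow> 1 / p k + 1 / q k = 1"
    and "\<And>k. k \<in> {1..T} \<Longrightarrow> continuous_on UNIV (f k)"
    and "\<And>k. k \<in> {1..T} \<Longrightarrow> a k > 0"
    and "\<And>k t. k \<in> {1..T} \<Longrightarrow> \<bar>f k t\<bar> \<le> a k * \<bar>t\<bar> powr q k + b k"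
    and "\<exists>k\<in>{1..T}. f k 0 \<noteq> 0"
  shows "(p_minus T p > q_plus T q + 1 \<longrightarrow>
           (\<forall>lam>0. \<exists>u. is_solution T p f lam u \<and> nontrivial T u)) \<and>
         (p_minus T p = q_plus T q + 1 \<longrightarrow>
           (\<exists>lamstar>0. \<forall>lam. 0 < lam \<and> lam < lamstar \<longrightarrow>
             (\<exists>u. is_solution T p f lam u \<and> nontrivial T u)))"
proof -
  define P where "P = p_minus T p"
  define Q where "Q = q_plus T q"
  define K where "K = drift_const T P Q a b"
  define \<gamma> where "\<gamma> = Q / (P - 1)"
  have "P > 1"
    using assms(3) by (simp add: P_def)
  have p: "P \<le> p k" if "k \<le> T" for k
    using that by (simp add: P_def p_minus_def)
  have q: "q k \<le> Q" if "k \<le> T" for k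
    using that by (simp add: Q_def q_plus_def)
  have "Q > 0"
    using assms(4)[of 0] q[of 0] by simp
  have "K > 0"
    unfolding K_def drift_const_def
    using assms(1,7) by (intro sum_pos add_pos_nonneg mult_pos_pos) auto
  have solvable: "\<exists>u. is_solution T p f lam u \<and> nontrivial T u"
    if "lam > 0" "\<sigma> \<ge> 1" and small: "lam * K * \<sigma> powr \<gamma> \<le> \<sigma> / 2" for lam \<sigma>
  proof -
    have "\<bar>flux p f lam s k - s\<bar> < \<sigma>" if "\<bar>s\<bar> = \<sigma>" "k \<le> T" for s k
    proof -
      have "\<bar>flux p f lam s k - s\<bar> \<le> \<sigma> / 2"
        using assms(4,7) p q \<open>P > 1\<close> \<open>Q > 0\<close> \<open>lam > 0\<close> \<open>\<sigma> \<ge> 1\<close> small that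
        by (intro flux_drift_bound[where P = P and Q = Q and q = q and a = a and b = b and T = T] assms(8))
           (auto simp: K_def \<gamma>_def less_imp_le)
      then show ?thesis
        using \<open>\<sigma> \<ge> 1\<close> by linarith
    qed
    moreover have "p k > 1" if "k \<le> T" for k
      using p[OF that] \<open>P > 1\<close> by simp
    ultimately obtain u where "is_solution T p f lam u"
      using solution_if_flux_keeps_sign[of T p f \<sigma> lam] assms(6) \<open>\<sigma> \<ge> 1\<close> by auto
    then show ?thesis
      using nontrivial_solution[of T p f lam u] \<open>lam > 0\<close> assms(9) by blast
  qed
  show ?thesis
    unfolding P_def[symmetric] Q_def[symmetric]
  proof (intro conjI impI allI)
    fix lam :: real
    assume "P > Q + 1" "lam > 0"
    then have "\<gamma> < 1"
      using \<open>P > 1\<close> by (simp add: \<gamma>_def)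
    \<comment> \<open>Any \<open>\<sigma>\<close> with \<open>2 * lam * K \<le> \<sigma> powr (1 - \<gamma>)\<close> will do; this is the least one that is \<open>\<ge> 1\<close>.\<close>
    define \<sigma> where "\<sigma> = max 1 (2 * lam * K) powr (1 / (1 - \<gamma>))"
    have "\<sigma> \<ge> 1"
      unfolding \<sigma>_def using \<open>\<gamma> < 1\<close> by (intro ge_one_powr_ge_zero) auto
    have "2 * lam * K \<le> \<sigma> powr (1 - \<gamma>)"
      using \<open>\<gamma> < 1\<close> by (simp add: \<sigma>_def powr_powr)
    then have "2 * lam * K * \<sigma> powr \<gamma> \<le> \<sigma> powr (1 - \<gamma>) * \<sigma> powr \<gamma>"
      by (intro mult_right_mono) auto
    also have "\<dots> = \<sigma>"
      using \<open>\<sigma> \<ge> 1\<close> by (simp flip: powr_add)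
    finally show "\<exists>u. is_solution T p f lam u \<and> nontrivial T u"
      using \<open>lam > 0\<close> \<open>\<sigma> \<ge> 1\<close> by (intro solvable[of lam \<sigma>]) auto
  next
    assume "P = Q + 1"
    \<comment> \<open>As \<open>\<gamma> = 1\<close>, the smallness condition is independent of \<open>\<sigma>\<close>, which can be taken to be \<open>1\<close>.\<close>
    show "\<exists>lamstar>0. \<forall>lam. 0 < lam \<and> lam < lamstar \<longrightarrow>
        (\<exists>u. is_solution T p f lam u \<and> nontrivial T u)"
    proof (intro exI[of _ "1 / (2 * K)"] conjI allI impI)
      show "0 < 1 / (2 * K)"
        using \<open>K > 0\<close> by simp
    next
      fix lam
      assume "0 < lam \<and> lam < 1 / (2 * K)"
      then show "\<exists>u. is_solution T p f lam u \<and> nontrivial T u"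
        using \<open>K > 0\<close> by (intro solvable[of lam 1]) (auto simp: field_simps)
    qed
  qed
qed

end
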